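(* Let $f$ be convex and let $g$ be anisotropically strongly convex with constant $\mu>0$ relative to $\phi_-$. Let $\{x^k\}_{k=0}^\infty$ be the sequence of backward-steps generated by the anisotropic proximal gradient method with step-size $\lambda=L^{-1}$. Then $\{F(x^{k+1})\}_{k=0}^\infty$ converges $R$-linearly; in particular, for all $k\ge0$ $$F(x^{k+1})-\inf F\le\big(1-\tfrac{\mu}{\mu+L}\big)^{k}\big(F(x^0)-\inf F\big).$$
   Context: $\Gamma_0(\mathbb{R}^n)$: proper lower semicontinuous convex functions $\mathbb{R}^n\to\overline{\mathbb{R}}$. Reference function: $\phi\in\Gamma_0(\mathbb{R}^n)$ has $\operatorname{dom}\phi=\mathbb{R}^n$ and is Legendre (essentially smooth and essentially strictly convex in the sense of Rockafellar); so $\nabla\phi:\mathbb{R}^n\to\operatorname{int}\operatorname{dom}\phi^*$ is a bijection with inverse $\nabla\phi^*$ ($\phi^*$ the convex conjugate). $\phi_-(x):=\phi(-x)$ and $\phi_-^*:=(\phi_-)^*=\phi^*(-\,\cdot)$. For $\lambda>0$, $(\lambda\star h)(x)=\lambda h(\lambda^{-1}x)$. $\operatorname{rge}$ denotes the range. Standing assumptions: $f\in\mathcal{C}^1(\mathbb{R}^n)$ has the anisotropic descent property relative to $\phi$ with constant $L>0$, i.e., $\operatorname{rge}\nabla f\subseteq\operatorname{rge}\nabla\phi$ and for all $\bar x,x\in\mathbb{R}^n$ $$f(x)\le f(\bar x)+\tfrac1L\star\phi\big(x-\bar x+L^{-1}\nabla\phi^*(\nabla f(\bar x))\big)-\tfrac1L\star\phi\big(L^{-1}\nabla\phi^*(\nabla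 f(\bar x))\big);$$ $g:\mathbb{R}^n\to\overline{\mathbb{R}}$ is proper lower semicontinuous; $F:=f+g$ satisfies $\inf F>-\infty$; and, $g$ being convex here, $\operatorname{dom}g^*\cap\operatorname{int}(\operatorname{dom}\phi_-^* )\ne\emptyset$. Anisotropic strong convexity of $h\in\Gamma_0(\mathbb{R}^n)$ relative to a (full-domain Legendre) function $\varphi$ with constant $\mu>0$: $\operatorname{rge}\partial h\supseteq\operatorname{rge}\nabla\varphi$ and for all $(\bar x,\bar v)\in\operatorname{gph}\partial h\cap(\mathbb{R}^n\times\operatorname{int}\operatorname{dom}\varphi^* )$ $$h(x)\ge h(\bar x)+\tfrac1\mu\star\varphi\big(x-\bar x+\mu^{-1}\nabla\varphi^*(\bar v)\big)-\tfrac1\mu\star\varphi\big(\mu^{-1}\nabla\varphi^*(\bar v)\big)\quad\forall x\in\mathbb{R}^n.$$ Anisotropic proximal gradient method with step-size $\lambda$: starting from $x^0\in\mathbb{R}^n$, for $k=0,1,\ldots$ $$y^k=x^k-\lambda\nabla\phi^*(\nabla f(x^k))\ \ (\text{forward-step}),\qquad x^{k+1}\in\operatorname*{arg\,min}_{x\in\mathbb{R}^n}\{g(x)+\lambda\star\phi(x-y^k)\}\ \ (\text{backward-step}).$$ A sequence $\{a_k\}$ converges $Q$-linearly to $a$ with rate $\rho$ if $\lim_{k\to\infty}\frac{|a_{k+1}-a|}{|a_k-a|}\le\rho$; it converges $R$-linearly to $a$ with rate $\rho$ if $|a_k-a|\le\varepsilon_k$ for some sequence $\varepsilon_k$ converging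 $Q$-linearly to $0$ with rate $\rho$. *)

theory Defs
  imports "HOL-Analysis.Analysis"
begin

section \<open>Extended-real-valued convex functions\<close>

definition edom :: "('a \<Rightarrow> ereal) \<Rightarrow> 'a set" where
  "edom h = {x. h x < \<infinity>}"

definition proper_fun :: "('a \<Rightarrow> ereal) \<Rightarrow> bool" where
  "proper_fun h \<longleftrightarrow> edom h \<noteq> {} \<and> (\<forall>x. h x > -\<infinity>)"

definition lsc_fun :: "('a::topological_space \<Rightarrow> ereal) \<Rightarrow> bool" where
  "lsc_fun h \<longleftrightarrow> (\<forall>x. h x \<le> Liminf (at x) h)"

text \<open>Convexity is convexity of the epigraph in \<open>'a \<times> real\<close>, which avoids the sum
  \<open>\<infinity> + (-\<infinity>)\<close>.\<close>

definition econvex :: "('a::real_vector \<Rightarrow> ereal) \<Rightarrow> bool" where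
  "econvex h \<longleftrightarrow> convex {(x, r::real). h x \<le> ereal r}"

definition Gamma0 :: "('a::euclidean_space \<Rightarrow> ereal) set" where
  "Gamma0 = {h. proper_fun h \<and> lsc_fun h \<and> econvex h}"

definition conjugate :: "('a::euclidean_space \<Rightarrow> ereal) \<Rightarrow> 'a \<Rightarrow> ereal" where
  "conjugate h v = (SUP x. ereal (v \<bullet> x) - h x)"

definition subdiff :: "('a::euclidean_space \<Rightarrow> ereal) \<Rightarrow> 'a \<Rightarrow> 'a set" where
  "subdiff h x = {v. \<forall>y. h y \<ge> h x + ereal (v \<bullet> (y - x))}"

definition reflect :: "('a::euclidean_space \<Rightarrow> ereal) \<Rightarrow> 'a \<Rightarrow> ereal" where
  "reflect h x = h (- x)"

definition epi_scale :: "real \<Rightarrow> ('a::euclidean_space \<Rightarrow> ereal) \<Rightarrow> 'a \<Rightarrow> ereal" where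
  "epi_scale c h x = ereal c * h ((1 / c) *\<^sub>R x)"


section \<open>Gradients\<close>

definition grad :: "('a::euclidean_space \<Rightarrow> real) \<Rightarrow> 'a \<Rightarrow> 'a" where
  "grad f x = (THE v. GDERIV f x :> v)"

definition C1 :: "('a::euclidean_space \<Rightarrow> real) \<Rightarrow> bool" where
  "C1 f \<longleftrightarrow> (\<forall>x. \<exists>v. GDERIV f x :> v) \<and> continuous_on UNIV (grad f)"

text \<open>The gradient of an extended-real-valued function is only defined at points near
  which the function is finite; this keeps the convention \<open>real_of_ereal \<infinity> = 0\<close> from
  creating spurious gradients.\<close>

definition has_egrad :: "('a::euclidean_space \<Rightarrow> ereal) \<Rightarrow> 'a \<Rightarrow> 'a \<Rightarrow> bool" where
  "has_egrad h x v \<longleftrightarrow>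
     x \<in> interior {y. \<bar>h y\<bar> \<noteq> \<infinity>} \<and> GDERIV (\<lambda>y. real_of_ereal (h y)) x :> v"

definition egrad :: "('a::euclidean_space \<Rightarrow> ereal) \<Rightarrow> 'a \<Rightarrow> 'a" where
  "egrad h x = (THE v. has_egrad h x v)"

definition rge_egrad :: "('a::euclidean_space \<Rightarrow> ereal) \<Rightarrow> 'a set" where
  "rge_egrad h = {v. \<exists>x. has_egrad h x v}"


section \<open>Legendre functions\<close>

definition essentially_smooth :: "('a::euclidean_space \<Rightarrow> ereal) \<Rightarrow> bool" where
  "essentially_smooth h \<longleftrightarrow>
     interior (edom h) \<noteq> {} \<and>
     (\<forall>x \<in> interior (edom h). \<exists>v. has_egrad h x v) \<and>
     (\<forall>X x. (\<forall>i::nat. X i \<in> interior (edom h)) \<and> X \<longlonglongrightarrow> x \<and> x \<in> frontier (interior (edom h))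
        \<longrightarrow> filterlim (\<lambda>i. norm (egrad h (X i))) at_top sequentially)"

definition strictly_convex_on :: "'a::euclidean_space set \<Rightarrow> ('a \<Rightarrow> ereal) \<Rightarrow> bool" where
  "strictly_convex_on C h \<longleftrightarrow>
     (\<forall>x\<in>C. \<forall>y\<in>C. \<forall>t::real. x \<noteq> y \<and> 0 < t \<and> t < 1 \<longrightarrow>
        h ((1 - t) *\<^sub>R x + t *\<^sub>R y) < ereal (1 - t) * h x + ereal t * h y)"

definition essentially_strictly_convex :: "('a::euclidean_space \<Rightarrow> ereal) \<Rightarrow> bool" where
  "essentially_strictly_convex h \<longleftrightarrow>
     (\<forall>C. convex C \<and> C \<subseteq> {x. subdiff h x \<noteq> {}} \<longrightarrow> strictly_convex_on C h)"

definition legendre :: "('a::euclidean_space \<Rightarrow> ereal) \<Rightarrow> bool" where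
  "legendre h \<longleftrightarrow> essentially_smooth h \<and> essentially_strictly_convex h"

definition reference_fun :: "('a::euclidean_space \<Rightarrow> ereal) \<Rightarrow> bool" where
  "reference_fun \<phi> \<longleftrightarrow> \<phi> \<in> Gamma0 \<and> edom \<phi> = UNIV \<and> legendre \<phi>"


section \<open>Anisotropic descent and strong convexity\<close>

definition anisotropic_descent ::
  "('a::euclidean_space \<Rightarrow> ereal) \<Rightarrow> real \<Rightarrow> ('a \<Rightarrow> real) \<Rightarrow> bool" where
  "anisotropic_descent \<phi> L f \<longleftrightarrow>
     range (grad f) \<subseteq> rge_egrad \<phi> \<and>
     (\<forall>xb x. ereal (f x) \<le> ereal (f xb)
        + epi_scale (1 / L) \<phi> (x - xb + (1 / L) *\<^sub>R egrad (conjugate \<phi>) (grad f xb))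
        - epi_scale (1 / L) \<phi> ((1 / L) *\<^sub>R egrad (conjugate \<phi>) (grad f xb)))"

definition anisotropic_strongly_convex ::
  "('a::euclidean_space \<Rightarrow> ereal) \<Rightarrow> real \<Rightarrow> ('a \<Rightarrow> ereal) \<Rightarrow> bool" where
  "anisotropic_strongly_convex \<phi> \<mu> h \<longleftrightarrow>
     h \<in> Gamma0 \<and>
     rge_egrad \<phi> \<subseteq> (\<Union>x. subdiff h x) \<and>
     (\<forall>xb vb. vb \<in> subdiff h xb \<and> vb \<in> interior (edom (conjugate \<phi>)) \<longrightarrow>
        (\<forall>x. h x \<ge> h xb
           + epi_scale (1 / \<mu>) \<phi> (x - xb + (1 / \<mu>) *\<^sub>R egrad (conjugate \<phi>) vb)
           - epi_scale (1 / \<mu>) \<phi> ((1 / \<mu>) *\<^sub>R egrad (conjugate \<phi>) vb)))"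


section \<open>The anisotropic proximal gradient method\<close>

definition objective :: "('a \<Rightarrow> real) \<Rightarrow> ('a \<Rightarrow> ereal) \<Rightarrow> 'a \<Rightarrow> ereal" where
  "objective f g x = ereal (f x) + g x"

definition anisotropic_prox_grad ::
  "('a::euclidean_space \<Rightarrow> ereal) \<Rightarrow> ('a \<Rightarrow> real) \<Rightarrow> ('a \<Rightarrow> ereal) \<Rightarrow> real
     \<Rightarrow> (nat \<Rightarrow> 'a) \<Rightarrow> (nat \<Rightarrow> 'a) \<Rightarrow> bool" where
  "anisotropic_prox_grad \<phi> f g c x y \<longleftrightarrow>
     (\<forall>k. y k = x k - c *\<^sub>R egrad (conjugate \<phi>) (grad f (x k)) \<and>
          is_arg_min (\<lambda>z. g z + epi_scale c \<phi> (z - y k)) (\<lambda>_. True) (x (Suc k)))"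


section \<open>Rates of convergence\<close>

text \<open>The requirement \<open>a k \<noteq> l\<close> makes the quotients meaningful; without it the convention
  \<open>r / 0 = 0\<close> would let, e.g., the divergent sequence 0, 1, 0, 1, \<dots> converge Q-linearly to 0.
  R-linear convergence still covers sequences that reach their limit.\<close>

definition Q_linear :: "(nat \<Rightarrow> real) \<Rightarrow> real \<Rightarrow> real \<Rightarrow> bool" where
  "Q_linear a l \<rho> \<longleftrightarrow>
     (\<forall>k. a k \<noteq> l) \<and>
     (\<exists>q\<le>\<rho>. (\<lambda>k. \<bar>a (Suc k) - l\<bar> / \<bar>a k - l\<bar>) \<longlonglongrightarrow> q)"

definition R_linear :: "(nat \<Rightarrow> real) \<Rightarrow> real \<Rightarrow> real \<Rightarrow> bool" where
  "R_linear a l \<rho> \<longleftrightarrow> (\<exists>\<epsilon>. Q_linear \<epsilon> 0 \<rho> \<and> (\<forall>k. \<bar>a k - l\<bar> \<le> \<epsilon> k))"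

end

theory Submission
  imports Defs
begin

text \<open>
  A single iteration from a point of finite objective contracts the gap \<open>F - inf F\<close> by the factor
  \<open>\<rho> = L / (L + \<mu>) = 1 - \<mu> / (\<mu> + L)\<close>. Let \<open>x'\<close> be the successor of \<open>x\<close>, and put
  \<open>p = \<nabla>\<phi>\<^sup>*(\<nabla>f(x))\<close>, \<open>v' = \<nabla>f(x')\<close>, \<open>p'\<close> a point with \<open>\<nabla>\<phi>(p') = v'\<close>, and
  \<open>u = L (x' - y) = p + L (x' - x)\<close>. Progress and remaining gap are both controlled by the
  same Bregman distance \<open>D = \<phi>(u) - \<phi>(p') - v' \<bullet> (u - p') \<ge> 0\<close>:

  \<^item> \<open>F(x) \<ge> F(x') + D / L\<close>. Convexity turns the descent property into a cocoercivity
    inequality for \<open>f\<close> between \<open>x\<close> and \<open>x'\<close> (\<open>descent_cocoercive\<close>); adding the comparison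
    of \<open>x'\<close> with \<open>x\<close> in the proximal subproblem cancels \<open>\<phi>(p)\<close> and leaves \<open>D\<close>.

  \<^item> \<open>F(z) \<ge> F(x') - D / \<mu>\<close> for every \<open>z\<close>. Optimality in the subproblem gives
    \<open>-\<nabla>\<phi>(u) \<in> \<partial>g(x')\<close> (\<open>fermat_convex_plus_smooth\<close>), and strong convexity of \<open>g\<close> at this
    subgradient bounds \<open>g(z)\<close> below by a shifted copy of \<open>\<phi>\<close>. Minorising that copy by the
    tangent of \<open>\<phi>\<close> at \<open>p'\<close> cancels the linear term \<open>v' \<bullet> (z - x')\<close> that the gradient
    inequality of \<open>f\<close> at \<open>x'\<close> contributes, so the bound does not depend on \<open>z\<close>.

  Weighting the two inequalities by \<open>L\<close> and \<open>\<mu>\<close> eliminates \<open>D\<close> (\<open>step_contraction\<close>).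
  An infinite initial value \<open>F(x\<^sup>0)\<close> makes the stated bound trivial, while \<open>F\<close> is finite at
  every later iterate; R-linear convergence is therefore deduced from the first iterate on.

  Strong convexity is stated through \<open>\<nabla>(\<phi>\<^sub>-)\<^sup>*\<close>, so the second inequality rests on the fact that
  this map inverts the gradient of the reflection of \<open>\<phi>\<close>. It follows from strict convexity: where
  an affine function touches a finite convex function at a single point \<open>q\<close>, the conjugate is
  differentiable at its slope with gradient \<open>q\<close> (\<open>egrad_conjugate_if_strict_support\<close>).
\<close>

section \<open>Gradients and convexity\<close>

lemma GDERIV_unique:
  fixes h :: "'a::euclidean_space \<Rightarrow> real"
  assumes "GDERIV h x :> v" "GDERIV h x :> w"
  shows "v = w"
proof -
  have "(\<lambda>d. d \<bullet> v) = (\<lambda>d. d \<bullet> w)"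
    using assms unfolding gderiv_def by (rule has_derivative_unique)
  then have "(v - w) \<bullet> v = (v - w) \<bullet> w" by (rule fun_cong)
  then have "(v - w) \<bullet> (v - w) = 0" by (simp add: inner_diff_right)
  then show ?thesis by simp
qed

lemma egrad_eqI: "has_egrad h x v \<Longrightarrow> egrad h x = v"
  unfolding egrad_def by (rule the_equality) (auto simp: has_egrad_def intro: GDERIV_unique)

lemma GDERIV_grad: "C1 f \<Longrightarrow> GDERIV f x :> grad f x"
  unfolding C1_def grad_def by (rule theI') (blast intro: GDERIV_unique)

text \<open>One-sided information along a short segment passes to the derivative. This covers both
  uses of a limit of difference quotients below: the gradient inequality and Fermat's rule.\<close>

lemma le_inner_if_GDERIV:
  fixes h :: "'a::euclidean_space \<Rightarrow> real"
  assumes "GDERIV h x :> v"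
    and le: "\<And>t. 0 < t \<Longrightarrow> t < 1 \<Longrightarrow> c * t \<le> h (x + t *\<^sub>R d) - h x"
  shows "c \<le> v \<bullet> d"
proof -
  have "(h has_derivative (\<lambda>z. z \<bullet> v)) (at (x + 0 *\<^sub>R d))"
    using assms(1) by (simp add: gderiv_def)
  moreover have "((\<lambda>t::real. x + t *\<^sub>R d) has_derivative (\<lambda>t. t *\<^sub>R d)) (at 0)"
    by (auto intro!: derivative_eq_intros)
  ultimately have "((\<lambda>t. h (x + t *\<^sub>R d)) has_derivative (\<lambda>t. (t *\<^sub>R d) \<bullet> v)) (at 0)"
    using has_derivative_compose by blast
  then have "((\<lambda>t. h (x + t *\<^sub>R d)) has_field_derivative (v \<bullet> d)) (at 0)"
    by (simp add: has_field_derivative_def inner_commute mult_commute_abs)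
  then have "((\<lambda>t. (h (x + t *\<^sub>R d) - h x) / t) \<longlongrightarrow> v \<bullet> d) (at 0)"
    by (simp add: DERIV_def)
  then have "((\<lambda>t. (h (x + t *\<^sub>R d) - h x) / t) \<longlongrightarrow> v \<bullet> d) (at_right 0)"
    by (rule tendsto_within_subset) simp

  moreover have "eventually (\<lambda>t. c \<le> (h (x + t *\<^sub>R d) - h x) / t) (at_right 0)"
    using eventually_at_right_real[of 0 1]
    by (rule eventually_mono) (auto simp: le pos_le_divide_eq)
  ultimately show ?thesis
    by (intro tendsto_lowerbound) auto
qed

lemma convex_on_GDERIV_ge:
  fixes f :: "'a::euclidean_space \<Rightarrow> real"
  assumes "convex_on UNIV f" "GDERIV f x :> v"
  shows "f x + v \<bullet> (z - x) \<le> f z"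
proof -
  have "f x - f z \<le> (- v) \<bullet> (z - x)"
  proof (rule le_inner_if_GDERIV)
    show "GDERIV (\<lambda>z. - f z) x :> - v"
      using assms(2) by (rule GDERIV_minus)
    fix t :: real assume "0 < t" "t < 1"
    then have "f ((1 - t) *\<^sub>R x + t *\<^sub>R z) \<le> (1 - t) * f x + t * f z"
      by (intro convex_onD[OF assms(1)]) auto
    moreover have "(1 - t) *\<^sub>R x + t *\<^sub>R z = x + t *\<^sub>R (z - x)"
      by (simp add: algebra_simps)
    ultimately show "(f x - f z) * t \<le> - f (x + t *\<^sub>R (z - x)) - - f x"
      by (simp add: algebra_simps)
  qed
  then show ?thesis by simp
qed

text \<open>Along the segment from the minimiser \<open>x\<close> to \<open>z\<close> the convex part lies below its chord, so
  the smooth part must rise at least as fast as that chord falls.\<close>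

lemma fermat_convex_plus_smooth:
  fixes g :: "'a::euclidean_space \<Rightarrow> ereal"
  assumes "proper_fun g" "econvex g" "GDERIV h x :> w"
    and min: "\<And>z. g x + ereal (h x) \<le> g z + ereal (h z)"
  shows "\<bar>g x\<bar> \<noteq> \<infinity>" and "- w \<in> subdiff g x"
proof -
  have ninf: "g z \<noteq> -\<infinity>" for z
    using assms(1) by (auto simp: proper_fun_def)
  obtain z0 where "g z0 < \<infinity>"
    using assms(1) by (auto simp: proper_fun_def edom_def)
  then have "g x \<noteq> \<infinity>" using min[of z0] by (cases "g z0") auto
  with ninf show fin: "\<bar>g x\<bar> \<noteq> \<infinity>" by (cases "g x") auto
  then obtain a where a: "g x = ereal a" by (cases "g x") auto
  show "- w \<in> subdiff g x"
    unfolding subdiff_def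
  proof (clarify)
    fix z
    show "g x + ereal ((- w) \<bullet> (z - x)) \<le> g z"
    proof (cases "g z")
      case (real b)
      have "a - b \<le> w \<bullet> (z - x)"
      proof (rule le_inner_if_GDERIV[OF assms(3)])
        fix t :: real assume t: "0 < t" "t < 1"
        have "(1 - t) *\<^sub>R (x, a) + t *\<^sub>R (z, b) \<in> {(x, r::real). g x \<le> ereal r}"
          using assms(2) t a real unfolding econvex_def by (intro convexD) auto
        then have "g (x + t *\<^sub>R (z - x)) \<le> ereal ((1 - t) * a + t * b)"
          by (simp add: algebra_simps)
        then have "g (x + t *\<^sub>R (z - x)) + ereal (h (x + t *\<^sub>R (z - x)))
            \<le> ereal ((1 - t) * a + t * b) + ereal (h (x + t *\<^sub>R (z - x)))"
          by (rule add_right_mono)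
        with min[of "x + t *\<^sub>R (z - x)"]
        have "ereal a + ereal (h x) \<le> ereal ((1 - t) * a + t * b) + ereal (h (x + t *\<^sub>R (z - x)))"
          unfolding a by (rule order_trans)
        then show "(a - b) * t \<le> h (x + t *\<^sub>R (z - x)) - h x"
          by (simp add: algebra_simps)
      qed
      then show ?thesis using a real by simp
    qed (use ninf in auto)
  qed
qed

section \<open>Differentiability of the conjugate\<close>

text \<open>Let \<open>\<psi>\<close> be \<open>hr\<close> minus its affine minorant at \<open>q\<close>, so that the conjugate of \<open>h\<close> at \<open>v + d\<close>
  is an affine function of \<open>d\<close> with slope \<open>q\<close> plus the supremum over \<open>x\<close> of
  \<open>d \<bullet> (x - q) - \<psi>(x)\<close>. On the sphere of radius \<open>r\<close> around \<open>q\<close> the continuous function \<open>\<psi>\<close> has a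
  positive minimum, and by convexity \<open>\<psi>\<close> then grows at least linearly outside it. Hence for small
  \<open>d\<close> only points within distance \<open>r\<close> of \<open>q\<close> matter, and the supremum is between \<open>0\<close> and
  \<open>r * norm d\<close>. As \<open>r\<close> is arbitrary, this is differentiability with gradient \<open>q\<close>.\<close>

lemma
  fixes h :: "'a::euclidean_space \<Rightarrow> ereal"
  assumes fin: "\<And>x. h x = ereal (hr x)"
    and conv: "convex_on UNIV hr"
    and strict: "\<And>x. x \<noteq> q \<Longrightarrow> hr q + v \<bullet> (x - q) < hr x"
  shows interior_edom_conjugate_if_strict_support: "v \<in> interior (edom (conjugate h))"
    and egrad_conjugate_if_strict_support: "egrad (conjugate h) v = q"
proof -
  define \<psi> where "\<psi> x = hr x - hr q - v \<bullet> (x - q)" for x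
  define c0 where "c0 = v \<bullet> q - hr q"
  have lower: "ereal (c0 + d \<bullet> q) \<le> conjugate h (v + d)" for d
    unfolding conjugate_def
    by (rule SUP_upper2[of q]) (auto simp: fin c0_def algebra_simps)
  have upper: "\<exists>\<delta>>0. \<forall>d. norm d \<le> \<delta> \<longrightarrow> conjugate h (v + d) \<le> ereal (c0 + d \<bullet> q + r * norm d)"
    if r: "r > 0" for r
  proof -
    have "continuous_on UNIV hr"
      using convex_on_continuous[OF open_UNIV conv] .
    then have "continuous_on (sphere q r) \<psi>"
      unfolding \<psi>_def by (intro continuous_intros) (auto intro: continuous_on_subset)
    moreover have "sphere q r \<noteq> {}" using r by simp
    ultimately obtain s where s: "s \<in> sphere q r" "\<And>x. x \<in> sphere q r \<Longrightarrow> \<psi> s \<le> \<psi> x"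
      using continuous_attains_inf[OF compact_sphere] by metis
    from s(1) r have "s \<noteq> q" by auto
    then have pos: "\<psi> s > 0" using strict[of s] by (simp add: \<psi>_def)
    have growth: "(\<psi> s / r) * norm (x - q) \<le> \<psi> x" if x: "norm (x - q) \<ge> r" for x
    proof -
      define \<tau> where "\<tau> = r / norm (x - q)"
      have n0: "norm (x - q) > 0" using x r by linarith
      have \<tau>: "0 < \<tau>" "\<tau> \<le> 1" using x r n0 by (auto simp: \<tau>_def)
      define e where "e = (1 - \<tau>) *\<^sub>R q + \<tau> *\<^sub>R x"
      have e: "e - q = \<tau> *\<^sub>R (x - q)" by (simp add: e_def algebra_simps)
      have "norm (e - q) = r" using n0 r by (simp add: e \<tau>_def)
      then have "\<psi> s \<le> \<psi> e" by (intro s(2)) (simp add: dist_norm norm_minus_commute)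
      also have "hr e \<le> (1 - \<tau>) * hr q + \<tau> * hr x"
        unfolding e_def using \<tau> by (intro convex_onD[OF conv]) auto
      then have "\<psi> e \<le> \<tau> * \<psi> x"
        unfolding \<psi>_def e by (simp add: algebra_simps)
      finally show ?thesis using n0 r by (simp add: \<tau>_def field_simps)
    qed
    have "conjugate h (v + d) \<le> ereal (c0 + d \<bullet> q + r * norm d)" if d: "norm d \<le> \<psi> s / r" for d
      unfolding conjugate_def
    proof (rule SUP_least)
      fix x
      have cs: "d \<bullet> (x - q) \<le> norm d * norm (x - q)" by (rule norm_cauchy_schwarz)
      have "d \<bullet> (x - q) \<le> \<psi> x + r * norm d"
      proof (cases "norm (x - q) \<ge> r")
        case True
        have "norm d * norm (x - q) \<le> (\<psi> s / r) * norm (x - q)"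
          using d by (rule mult_right_mono) simp
        moreover have "0 \<le> r * norm d" using r by simp
        ultimately show ?thesis using cs growth[OF True] by linarith
      next
        case False
        then have "norm d * norm (x - q) \<le> norm d * r" by (intro mult_left_mono) auto
        moreover have "0 \<le> \<psi> x" using strict[of x] by (cases "x = q") (auto simp: \<psi>_def)
        ultimately show ?thesis using cs by (simp add: mult.commute)
      qed
      then show "ereal ((v + d) \<bullet> x) - h x \<le> ereal (c0 + d \<bullet> q + r * norm d)"
        by (simp add: fin c0_def \<psi>_def algebra_simps)
    qed
    then show ?thesis using pos r by (intro exI[of _ "\<psi> s / r"]) auto
  qed
  define k where "k w = real_of_ereal (conjugate h w)" for w
  have sandwich: "\<exists>\<delta>>0. \<forall>d. norm d \<le> \<delta> \<longrightarrow> conjugate h (v + d) = ereal (k (v + d))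
      \<and> c0 + d \<bullet> q \<le> k (v + d) \<and> k (v + d) \<le> c0 + d \<bullet> q + r * norm d" if "r > 0" for r
  proof -
    obtain \<delta> where \<delta>: "\<delta> > 0"
      "\<And>d. norm d \<le> \<delta> \<Longrightarrow> conjugate h (v + d) \<le> ereal (c0 + d \<bullet> q + r * norm d)"
      using upper[OF \<open>r > 0\<close>] by blast
    have "conjugate h (v + d) = ereal (k (v + d))
      \<and> c0 + d \<bullet> q \<le> k (v + d) \<and> k (v + d) \<le> c0 + d \<bullet> q + r * norm d" if "norm d \<le> \<delta>" for d
      using lower[of d] \<delta>(2)[OF that] by (cases "conjugate h (v + d)") (auto simp: k_def)
    with \<delta>(1) show ?thesis by blast
  qed
  have kv: "k v = c0"
    using sandwich[of 1] by (auto dest: spec[of _ 0])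
  obtain \<delta>1 where \<delta>1: "\<delta>1 > 0" "\<And>d. norm d \<le> \<delta>1 \<Longrightarrow> conjugate h (v + d) = ereal (k (v + d))"
    using sandwich[of 1] by auto
  have fin_ball: "conjugate h w = ereal (k w)" if "w \<in> ball v \<delta>1" for w
    using \<delta>1(2)[of "w - v"] that by (simp add: dist_norm norm_minus_commute)
  show "v \<in> interior (edom (conjugate h))"
    by (rule interiorI[OF open_ball[of v \<delta>1]]) (use \<delta>1(1) fin_ball in \<open>auto simp: edom_def\<close>)
  have "has_egrad (conjugate h) v q"
    unfolding has_egrad_def
  proof
    show "v \<in> interior {y. \<bar>conjugate h y\<bar> \<noteq> \<infinity>}"
      by (rule interiorI[OF open_ball[of v \<delta>1]]) (use \<delta>1(1) fin_ball in auto)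
    have "(k has_derivative (\<lambda>d. d \<bullet> q)) (at v)"
      unfolding has_derivative_at_alt
    proof (intro conjI allI impI)
      show "bounded_linear (\<lambda>d. d \<bullet> q)" by (rule bounded_linear_inner_left)
      fix e :: real assume "0 < e"
      then obtain \<delta> where \<delta>: "\<delta> > 0" "\<And>d. norm d \<le> \<delta> \<Longrightarrow>
          c0 + d \<bullet> q \<le> k (v + d) \<and> k (v + d) \<le> c0 + d \<bullet> q + e * norm d"
        using sandwich by meson
      have "norm (k w - k v - (w - v) \<bullet> q) \<le> e * norm (w - v)" if "norm (w - v) < \<delta>" for w
        using \<delta>(2)[of "w - v"] that by (simp add: kv abs_le_iff)
      with \<delta>(1) show "\<exists>d>0. \<forall>y. norm (y - v) < d \<longrightarrow>
          norm (k y - k v - (y - v) \<bullet> q) \<le> e * norm (y - v)" by blast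
    qed
    then show "GDERIV (\<lambda>y. real_of_ereal (conjugate h y)) v :> q"
      unfolding gderiv_def k_def .
  qed
  then show "egrad (conjugate h) v = q" by (rule egrad_eqI)
qed

section \<open>Reference functions\<close>

context
  fixes \<phi> :: "'a::euclidean_space \<Rightarrow> ereal" and \<phi>r :: "'a \<Rightarrow> real"
  assumes ref: "reference_fun \<phi>"
  defines "\<phi>r \<equiv> \<lambda>x. real_of_ereal (\<phi> x)"
begin

lemma reference_fun_finite: "\<phi> x = ereal (\<phi>r x)"
proof -
  have "\<phi> x > -\<infinity>" "x \<in> edom \<phi>"
    using ref by (auto simp: reference_fun_def Gamma0_def proper_fun_def)
  then show ?thesis by (cases "\<phi> x") (auto simp: edom_def \<phi>r_def)
qed

lemma reference_fun_convex: "convex_on UNIV \<phi>r"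
proof (rule convex_onI)
  fix t :: real and x z assume t: "0 < t" "t < 1"
  have "convex {(x, r::real). \<phi> x \<le> ereal r}"
    using ref by (simp add: reference_fun_def Gamma0_def econvex_def)
  then have "(1 - t) *\<^sub>R (x, \<phi>r x) + t *\<^sub>R (z, \<phi>r z) \<in> {(x, r::real). \<phi> x \<le> ereal r}"
    using t by (intro convexD) (auto simp: reference_fun_finite)
  then show "\<phi>r ((1 - t) *\<^sub>R x + t *\<^sub>R z) \<le> (1 - t) * \<phi>r x + t * \<phi>r z"
    by (simp add: reference_fun_finite)
qed simp

lemma reference_fun_GDERIV: "\<exists>v. GDERIV \<phi>r x :> v"
  using ref
  by (auto simp: reference_fun_def legendre_def essentially_smooth_def has_egrad_def \<phi>r_def)

text \<open>A reference function is differentiable everywhere, so its subdifferential is nowhere empty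
  and essential strict convexity is strict convexity on the whole space. The midpoint of \<open>q\<close> and
  \<open>x\<close> then shows that the tangent at \<open>q\<close> touches the graph only there.\<close>

lemma reference_fun_strict_support:
  assumes "GDERIV \<phi>r q :> v" "x \<noteq> q"
  shows "\<phi>r q + v \<bullet> (x - q) < \<phi>r x"
proof -
  have "subdiff \<phi> z \<noteq> {}" for z
  proof -
    obtain w where "GDERIV \<phi>r z :> w" using reference_fun_GDERIV by blast
    then have "w \<in> subdiff \<phi> z"
      using convex_on_GDERIV_ge[OF reference_fun_convex]
      by (auto simp: subdiff_def reference_fun_finite)
    then show ?thesis by blast
  qed
  then have "strictly_convex_on UNIV \<phi>"
    using ref by (auto simp: reference_fun_def legendre_def essentially_strictly_convex_def)
  then have "\<phi> ((1 - 1/2) *\<^sub>R q + (1/2) *\<^sub>R x) < ereal (1 - 1/2) * \<phi> q + ereal (1/2) * \<phi> x"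
    using assms(2) by (intro strictly_convex_on_def[THEN iffD1, rule_format]) auto
  then have "\<phi>r ((1/2) *\<^sub>R q + (1/2) *\<^sub>R x) < \<phi>r q / 2 + \<phi>r x / 2"
    by (simp add: reference_fun_finite)
  moreover have "\<phi>r q + v \<bullet> (((1/2) *\<^sub>R q + (1/2) *\<^sub>R x) - q) \<le> \<phi>r ((1/2) *\<^sub>R q + (1/2) *\<^sub>R x)"
    by (rule convex_on_GDERIV_ge[OF reference_fun_convex assms(1)])
  moreover have "((1/2) *\<^sub>R q + (1/2) *\<^sub>R x) - q = (1/2) *\<^sub>R (x - q)"
    by (simp add: algebra_simps flip: scaleR_add_left)
  ultimately show ?thesis by simp
qed

text \<open>This makes the strong convexity inequality of \<open>g\<close> applicable at the subgradient \<open>- v\<close>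
  produced by Fermat's rule, with \<open>- q\<close> as the value of the inverse gradient map.\<close>

lemma reference_fun_conjugate_reflect:
  assumes "GDERIV \<phi>r q :> v"
  shows "- v \<in> interior (edom (conjugate (reflect \<phi>)))"
    and "egrad (conjugate (reflect \<phi>)) (- v) = - q"
proof -
  have fin: "reflect \<phi> x = ereal (\<phi>r (- x))" for x
    by (simp add: reflect_def reference_fun_finite)
  have conv: "convex_on UNIV (\<lambda>x. \<phi>r (- x))"
  proof (rule convex_onI)
    fix t :: real and x z :: 'a assume "0 < t" "t < 1"
    then show "\<phi>r (- ((1 - t) *\<^sub>R x + t *\<^sub>R z)) \<le> (1 - t) * \<phi>r (- x) + t * \<phi>r (- z)"
      using convex_onD[OF reference_fun_convex, of t "- x" "- z"] by simp
  qed simp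
  have strict: "\<phi>r (- (- q)) + (- v) \<bullet> (x - (- q)) < \<phi>r (- x)" if "x \<noteq> - q" for x
  proof -
    have "- x \<noteq> q" using that by auto
    then show ?thesis
      using reference_fun_strict_support[OF assms, of "- x"]
      by (simp add: inner_diff_right inner_add_right)
  qed
  show "- v \<in> interior (edom (conjugate (reflect \<phi>)))"
    by (rule interior_edom_conjugate_if_strict_support[OF fin conv strict])
  show "egrad (conjugate (reflect \<phi>)) (- v) = - q"
    by (rule egrad_conjugate_if_strict_support[OF fin conv strict])
qed

lemma epi_scale_reference_fun: "epi_scale c \<phi> x = ereal (c * \<phi>r ((1 / c) *\<^sub>R x))"
  by (simp add: epi_scale_def reference_fun_finite)

section \<open>One step of the method\<close>

text \<open>For any \<open>z\<close>, the tangent of \<open>f\<close> at \<open>x'\<close> lies below \<open>f(z)\<close>, which lies below the descent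
  bound based at \<open>x\<close>. The comparison is sharpest at the \<open>z\<close> where the argument of \<open>\<phi>\<close> in the
  descent bound, \<open>L (z - x) + p\<close>, is the point \<open>p'\<close> with \<open>\<nabla>\<phi>(p') = v'\<close>;
  the term divided by \<open>L\<close> is then the Bregman distance of \<open>\<phi>\<close> from \<open>p'\<close> to \<open>p\<close>.\<close>

lemma descent_cocoercive:
  fixes x p' :: 'a
  assumes "L > 0" "anisotropic_descent \<phi> L f" "convex_on UNIV f" "GDERIV f x' :> v'"
  defines "p \<equiv> egrad (conjugate \<phi>) (grad f x)"
  shows "f x' + v' \<bullet> (x - x') + (\<phi>r p - \<phi>r p' - v' \<bullet> (p - p')) / L \<le> f x"
proof -
  define z where "z = x + (1 / L) *\<^sub>R (p' - p)"
  have "f x' + v' \<bullet> (z - x') \<le> f z"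
    by (rule convex_on_GDERIV_ge[OF assms(3,4)])
  moreover have "f z \<le> f x + \<phi>r p' / L - \<phi>r p / L"
  proof -
    have "L *\<^sub>R (z - x + (1 / L) *\<^sub>R p) = p'" "L *\<^sub>R (1 / L) *\<^sub>R p = p"
      using \<open>L > 0\<close> by (auto simp: z_def algebra_simps)
    moreover have "ereal (f z) \<le> ereal (f x) + epi_scale (1 / L) \<phi> (z - x + (1 / L) *\<^sub>R p)
        - epi_scale (1 / L) \<phi> ((1 / L) *\<^sub>R p)"
      using assms(2) unfolding anisotropic_descent_def p_def by blast
    ultimately show ?thesis by (simp add: epi_scale_reference_fun)
  qed
  moreover have "v' \<bullet> (z - x') = v' \<bullet> (x - x') - (v' \<bullet> (p - p')) / L"
    by (simp add: z_def inner_diff_right inner_add_right diff_divide_distrib algebra_simps)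
  ultimately show ?thesis by (simp add: diff_divide_distrib)
qed

text \<open>The facts \<open>decrease\<close> and \<open>gap\<close> in the proof are the two inequalities in which the Bregman
  distance \<open>D\<close> enters with opposite signs; weights \<open>L\<close> and \<open>\<mu>\<close> make it cancel. The comparison
  point \<open>z\<close> stays free so that the inequality passes to the infimum over \<open>z\<close>.\<close>

lemma step_contraction:
  assumes L: "L > 0" and f: "C1 f" "anisotropic_descent \<phi> L f" "convex_on UNIV f"
    and g: "proper_fun g" and \<mu>: "\<mu> > 0" "anisotropic_strongly_convex (reflect \<phi>) \<mu> g"
    and y: "y = x - (1 / L) *\<^sub>R egrad (conjugate \<phi>) (grad f x)"
    and x': "is_arg_min (\<lambda>z. g z + epi_scale (1 / L) \<phi> (z - y)) (\<lambda>_. True) x'"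
  shows "\<bar>g x'\<bar> \<noteq> \<infinity>"
    and "\<bar>g x\<bar> \<noteq> \<infinity> \<Longrightarrow> \<bar>g z\<bar> \<noteq> \<infinity> \<Longrightarrow>
      (L + \<mu>) * (f x' + real_of_ereal (g x')) \<le>
      L * (f x + real_of_ereal (g x)) + \<mu> * (f z + real_of_ereal (g z))"
proof -
  define p where "p = egrad (conjugate \<phi>) (grad f x)"
  define u where "u = L *\<^sub>R (x' - y)"
  define v' where "v' = grad f x'"
  have v': "GDERIV f x' :> v'" unfolding v'_def by (rule GDERIV_grad[OF f(1)])
  have "v' \<in> rge_egrad \<phi>" using f(2) by (auto simp: anisotropic_descent_def v'_def)
  then obtain p' where p': "GDERIV \<phi>r p' :> v'"
    by (auto simp: rge_egrad_def has_egrad_def \<phi>r_def)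
  obtain w where w: "GDERIV \<phi>r u :> w" using reference_fun_GDERIV by blast
  have min: "g x' + ereal (\<phi>r u / L) \<le> g z + ereal (\<phi>r (L *\<^sub>R (z - y)) / L)" for z
    using x' unfolding is_arg_min_def by (auto simp: epi_scale_reference_fun u_def not_less)
  have "((\<lambda>z. L *\<^sub>R (z - y)) has_derivative (\<lambda>d. L *\<^sub>R d)) (at x')"
    by (auto intro!: derivative_eq_intros)
  then have "((\<lambda>z. \<phi>r (L *\<^sub>R (z - y))) has_derivative (\<lambda>d. (L *\<^sub>R d) \<bullet> w)) (at x')"
    using w unfolding gderiv_def u_def by (rule has_derivative_compose)
  then have "((\<lambda>z. \<phi>r (L *\<^sub>R (z - y)) / L) has_derivative (\<lambda>d. ((L *\<^sub>R d) \<bullet> w) / L)) (at x')"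
    using L by (auto intro!: derivative_eq_intros)
  then have "GDERIV (\<lambda>z. \<phi>r (L *\<^sub>R (z - y)) / L) x' :> w"
    using L by (simp add: gderiv_def)
  moreover have cvx: "econvex g"
    using \<mu>(2) by (simp add: anisotropic_strongly_convex_def Gamma0_def)
  moreover note min[unfolded u_def]
  ultimately have gx': "\<bar>g x'\<bar> \<noteq> \<infinity>" and sub: "- w \<in> subdiff g x'"
    using fermat_convex_plus_smooth[OF g cvx, of "\<lambda>z. \<phi>r (L *\<^sub>R (z - y)) / L" x' w] by auto
  show "\<bar>g x'\<bar> \<noteq> \<infinity>" by fact
  assume gx: "\<bar>g x\<bar> \<noteq> \<infinity>" and gz: "\<bar>g z\<bar> \<noteq> \<infinity>"
  define b where "b = real_of_ereal (g x)"
  define b' where "b' = real_of_ereal (g x')"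
  define c where "c = real_of_ereal (g z)"
  have b: "g x = ereal b" "g x' = ereal b'" "g z = ereal c"
    using gx gx' gz by (auto simp: b_def b'_def c_def ereal_real)
  define D where "D = \<phi>r u - \<phi>r p' - v' \<bullet> (u - p')"
  have u: "u = p + L *\<^sub>R (x' - x)" using L by (simp add: u_def y p_def algebra_simps)
  have Ly: "L *\<^sub>R (x - y) = p" using L by (simp add: y p_def)
  have decrease: "f x' + b' + D / L \<le> f x + b"
  proof -
    have "f x' + v' \<bullet> (x - x') + (\<phi>r p - \<phi>r p' - v' \<bullet> (p - p')) / L \<le> f x"
      unfolding p_def by (rule descent_cocoercive[OF L f(2,3) v'])
    moreover have "b' + \<phi>r u / L \<le> b + \<phi>r p / L"
      using min[of x] by (simp add: b Ly)
    moreover have "v' \<bullet> (p - p') / L - v' \<bullet> (x - x') = v' \<bullet> (u - p') / L"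
      using L by (simp add: u inner_diff_right inner_add_right field_simps)
    ultimately show ?thesis by (simp add: D_def diff_divide_distrib)
  qed
  have gap: "f x' + b' - D / \<mu> \<le> f z + c"
  proof -
    have "f x' + v' \<bullet> (z - x') \<le> f z"
      by (rule convex_on_GDERIV_ge[OF f(3) v'])
    moreover have "b' + \<phi>r (u + \<mu> *\<^sub>R (x' - z)) / \<mu> - \<phi>r u / \<mu> \<le> c"
    proof -
      have arg: "\<mu> *\<^sub>R (z - x' + (1 / \<mu>) *\<^sub>R (- u)) = - (u + \<mu> *\<^sub>R (x' - z))"
        "\<mu> *\<^sub>R (1 / \<mu>) *\<^sub>R (- u) = - u"
        using \<mu>(1) by (auto simp: algebra_simps)
      have "g z \<ge> g x' + epi_scale (1 / \<mu>) (reflect \<phi>) (z - x' + (1 / \<mu>) *\<^sub>R (- u))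
           - epi_scale (1 / \<mu>) (reflect \<phi>) ((1 / \<mu>) *\<^sub>R (- u))"
        using \<mu>(2) sub reference_fun_conjugate_reflect[OF w]
        unfolding anisotropic_strongly_convex_def by metis
      moreover have "epi_scale (1 / \<mu>) (reflect \<phi>) (z - x' + (1 / \<mu>) *\<^sub>R (- u))
          = ereal (\<phi>r (u + \<mu> *\<^sub>R (x' - z)) / \<mu>)"
        "epi_scale (1 / \<mu>) (reflect \<phi>) ((1 / \<mu>) *\<^sub>R (- u)) = ereal (\<phi>r u / \<mu>)"
        unfolding epi_scale_def div_by_1 divide_divide_eq_right mult_1 arg
        by (simp_all add: arg reflect_def reference_fun_finite add.commute)
      ultimately show ?thesis by (simp add: b)
    qed
    moreover have "\<phi>r p' / \<mu> + v' \<bullet> (u + \<mu> *\<^sub>R (x' - z) - p') / \<mu> \<le> \<phi>r (u + \<mu> *\<^sub>R (x' - z)) / \<mu>"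
      using convex_on_GDERIV_ge[OF reference_fun_convex p'] \<mu>(1)
      by (simp add: divide_right_mono flip: add_divide_distrib)
    moreover have "v' \<bullet> (u + \<mu> *\<^sub>R (x' - z) - p') / \<mu> = v' \<bullet> (u - p') / \<mu> - v' \<bullet> (z - x')"
      using \<mu>(1) by (simp add: inner_diff_right inner_add_right field_simps)
    ultimately show ?thesis by (simp add: D_def diff_divide_distrib)
  qed
  have "L * (f x' + b') + D \<le> L * (f x + b)"
    using mult_left_mono[OF decrease, of L] L by (simp add: algebra_simps)
  moreover have "\<mu> * (f x' + b') - D \<le> \<mu> * (f z + c)"
    using mult_left_mono[OF gap, of \<mu>] \<mu>(1) by (simp add: algebra_simps)
  ultimately show "(L + \<mu>) * (f x' + real_of_ereal (g x')) \<le>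
      L * (f x + real_of_ereal (g x)) + \<mu> * (f z + real_of_ereal (g z))"
    by (simp add: algebra_simps flip: b_def b'_def c_def)
qed

end

section \<open>Linear convergence\<close>

theorem corollary6p11:
  fixes \<phi> g :: "real ^ 'n \<Rightarrow> ereal"
    and f :: "real ^ 'n \<Rightarrow> real"
    and L \<mu> :: real
    and x y :: "nat \<Rightarrow> real ^ 'n"
  assumes "reference_fun \<phi>"
    and "L > 0"
    and "C1 f"
    and "anisotropic_descent \<phi> L f"
    and "proper_fun g" and "lsc_fun g"
    and "(INF z. objective f g z) > -\<infinity>"
    and "edom (conjugate g) \<inter> interior (edom (conjugate (reflect \<phi>))) \<noteq> {}"
    and "convex_on UNIV f"
    and "\<mu> > 0"
    and "anisotropic_strongly_convex (reflect \<phi>) \<mu> g"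
    and "anisotropic_prox_grad \<phi> f g (1 / L) x y"
  shows "(\<exists>(a :: nat \<Rightarrow> real) (m :: real).
            (\<forall>k. objective f g (x (Suc k)) = ereal (a k)) \<and>
            (INF z. objective f g z) = ereal m \<and>
            R_linear a m (1 - \<mu> / (\<mu> + L))) \<and>
         (\<forall>k. objective f g (x (Suc k)) - (INF z. objective f g z)
            \<le> ereal ((1 - \<mu> / (\<mu> + L)) ^ k)
                * (objective f g (x 0) - (INF z. objective f g z)))"
proof -
  define \<rho> where "\<rho> = 1 - \<mu> / (\<mu> + L)"
  have \<rho>: "\<rho> > 0" "\<rho> \<le> 1" and \<rho>_mult: "(L + \<mu>) * \<rho> = L"
    using assms(2,10) by (auto simp: \<rho>_def field_simps)
  define F where "F z = f z + real_of_ereal (g z)" for z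
  have obj: "objective f g z = ereal (F z)" if "\<bar>g z\<bar> \<noteq> \<infinity>" for z
    using that by (auto simp: objective_def F_def)
  have step: "y k = x k - (1 / L) *\<^sub>R egrad (conjugate \<phi>) (grad f (x k))"
    "is_arg_min (\<lambda>z. g z + epi_scale (1 / L) \<phi> (z - y k)) (\<lambda>_. True) (x (Suc k))" for k
    using assms(12) unfolding anisotropic_prox_grad_def by blast+
  note contr = step_contraction[OF assms(1-4,9,5,10,11) step]
  have fin: "\<bar>g (x (Suc k))\<bar> \<noteq> \<infinity>" for k by (rule contr(1))
  obtain m where m: "(INF z. objective f g z) = ereal m"
  proof (cases "INF z. objective f g z")
    case PInf
    have "(INF z. objective f g z) \<le> objective f g (x (Suc 0))" by (rule INF_lower) simp
    with PInf obj[OF fin] show ?thesis by simp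
  qed (use assms(7) that in auto)
  have m_le: "m \<le> F z" if "\<bar>g z\<bar> \<noteq> \<infinity>" for z
    using INF_lower[of z UNIV "objective f g"] by (simp add: m obj[OF that])
  have Q: "F (x (Suc k)) - m \<le> \<rho> * (F (x k) - m)" if k: "\<bar>g (x k)\<bar> \<noteq> \<infinity>" for k
  proof -
    \<comment> \<open>the step inequality, solved for \<open>F z\<close>, so that the infimum over \<open>z\<close> can be taken\<close>
    have "ereal (((L + \<mu>) * F (x (Suc k)) - L * F (x k)) / \<mu>) \<le> objective f g z" for z
    proof (cases "\<bar>g z\<bar> = \<infinity>")
      case True
      then have "g z = \<infinity>" using assms(5) by (auto simp: proper_fun_def)
      then show ?thesis by (simp add: objective_def)
    next
      case False
      have "(L + \<mu>) * F (x (Suc k)) \<le> L * F (x k) + \<mu> * F z"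
        unfolding F_def by (rule contr(2)[OF k False])
      then show ?thesis using assms(10) by (simp add: obj[OF False] field_simps)
    qed
    then have "ereal (((L + \<mu>) * F (x (Suc k)) - L * F (x k)) / \<mu>) \<le> ereal m"
      unfolding m[symmetric] by (intro INF_greatest)
    then have "(L + \<mu>) * F (x (Suc k)) - L * F (x k) \<le> \<mu> * m"
      using assms(10) by (simp add: field_simps)
    then have "(L + \<mu>) * (F (x (Suc k)) - m) \<le> L * (F (x k) - m)"
      by (simp add: algebra_simps)
    also have "\<dots> = (L + \<mu>) * (\<rho> * (F (x k) - m))"
      by (simp add: \<rho>_mult flip: mult.assoc)
    finally show ?thesis using assms(2,10) by simp
  qed
  define a where "a k = F (x (Suc k))" for k
  have a: "a k - m \<le> \<rho> ^ k * (a 0 - m)" for k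
  proof (induction k)
    case (Suc k)
    have "a (Suc k) - m \<le> \<rho> * (a k - m)" unfolding a_def by (rule Q[OF fin])
    also have "\<dots> \<le> \<rho> * (\<rho> ^ k * (a 0 - m))" using Suc \<rho>(1) by simp
    finally show ?case by (simp add: mult.assoc)
  qed simp
  have "R_linear a m \<rho>"
    unfolding R_linear_def
  proof (intro exI conjI allI)
    \<comment> \<open>the summand \<open>1\<close> keeps the majorant nonzero when the infimum is attained after one step\<close>
    define C where "C = a 0 - m + 1"
    have C: "C > 0" using m_le[OF fin, of 0] by (simp add: C_def a_def)
    show "Q_linear (\<lambda>k. \<rho> ^ k * C) 0 \<rho>"
      unfolding Q_linear_def
    proof (intro conjI allI exI)
      show "(\<lambda>k. \<bar>\<rho> ^ Suc k * C - 0\<bar> / \<bar>\<rho> ^ k * C - 0\<bar>) \<longlonglongrightarrow> \<rho>"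
        using \<rho>(1) C by (simp add: abs_mult)
    qed (use \<rho>(1) C in auto)
    fix k
    have "\<rho> ^ k * (a 0 - m) \<le> \<rho> ^ k * C" using \<rho>(1) by (simp add: C_def)
    then show "\<bar>a k - m\<bar> \<le> \<rho> ^ k * C"
      using a[of k] m_le[OF fin, of k] by (simp add: a_def)
  qed
  moreover have "objective f g (x (Suc k)) - ereal m
      \<le> ereal (\<rho> ^ k) * (objective f g (x 0) - ereal m)" for k
  proof (cases "\<bar>g (x 0)\<bar> = \<infinity>")
    case True
    then have "g (x 0) = \<infinity>" using assms(5) by (auto simp: proper_fun_def)
    then show ?thesis using \<rho>(1) by (simp add: objective_def)
  next
    case False
    have "a 0 - m \<le> \<rho> * (F (x 0) - m)" unfolding a_def by (rule Q[OF False])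
    also have "\<dots> \<le> 1 * (F (x 0) - m)"
      using \<rho>(2) m_le[OF False] by (intro mult_right_mono) auto
    finally have "\<rho> ^ k * (a 0 - m) \<le> \<rho> ^ k * (F (x 0) - m)" using \<rho>(1) by simp
    with a[of k] show ?thesis by (simp add: obj[OF fin] obj[OF False] a_def)
  qed
  moreover have "objective f g (x (Suc k)) = ereal (a k)" for k
    unfolding a_def by (rule obj[OF fin])
  ultimately show ?thesis
    unfolding m \<rho>_def[symmetric] by blast
qed

end
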